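(* Let $\mathbf{E}$ be a Euclidean space and let $A,B\subset\mathbf{E}$ be two affine subspaces with $A\cap B\ne\emptyset$. Then the Douglas-Rachford algorithm $x_{n+1}=T_{DR}x_n$ ($n=0,1,2,\dots$) converges for any starting point $x_0\in\mathbf{E}$ with linear rate to the intersection $A\cap B$ if and only if $A^\perp\cap B^\perp=\{0\}$.
   Context: $\mathbf{E}$ is a (finite-dimensional) Euclidean space. For a nonempty closed convex set $C$, $P_C$ is the metric projector (nearest-point map) and $R_C=2P_C-\mathrm{Id}$ the reflector. The Douglas-Rachford operator is $T_{DR}=\frac12(R_AR_B+\mathrm{Id})$. For an affine subspace $A$, $A^\perp$ denotes the orthogonal complement of the linear subspace parallel to $A$, i.e. $A^\perp=(A-a)^\perp$ for any $a\in A$. With $d(x,\Omega)=\inf_{y\in\Omega}\|x-y\|$, "converges for any starting point with linear rate to $A\cap B$" means: there is $q\in[0,1)$ such that for every $x_0\in\mathbf{E}$ the iterates satisfy $d(x_{n+1},A\cap B)\le q\,d(x_n,A\cap B)$ for all $n\ge0$. *)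

theory Defs
  imports "HOL-Analysis.Analysis"
begin

text \<open>The metric projector onto \<open>C\<close> is \<^const>\<open>closest_point\<close>, and \<open>d(x, S)\<close> is \<^const>\<open>infdist\<close>
  (a genuine infimum of distances for nonempty \<open>S\<close>, the only case that matters here).\<close>

definition reflector :: "'a::euclidean_space set \<Rightarrow> 'a \<Rightarrow> 'a" where
  "reflector C x = 2 *\<^sub>R closest_point C x - x"

definition douglas_rachford :: "'a::euclidean_space set \<Rightarrow> 'a set \<Rightarrow> 'a \<Rightarrow> 'a" where
  "douglas_rachford A B x = (1/2) *\<^sub>R (reflector A (reflector B x) + x)"

text \<open>The rate \<open>q\<close> is uniform over all starting points.\<close>

definition converges_linearly_to :: "('a::metric_space \<Rightarrow> 'a) \<Rightarrow> 'a set \<Rightarrow> bool" where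
  "converges_linearly_to T S \<longleftrightarrow>
     (\<exists>q::real. 0 \<le> q \<and> q < 1 \<and>
        (\<forall>x0 n. infdist ((T ^^ Suc n) x0) S \<le> q * infdist ((T ^^ n) x0) S))"

definition parallel_subspace :: "'a::euclidean_space set \<Rightarrow> 'a set" where
  "parallel_subspace A = (THE L. subspace L \<and> affine_parallel A L)"

text \<open>Only meaningful for nonempty affine \<open>A\<close>. It differs from the library's \<open>A\<^sup>\<bottom>\<close>, which
  does not translate \<open>A\<close> to the origin.\<close>

definition affine_perp :: "'a::euclidean_space set \<Rightarrow> 'a set" where
  "affine_perp A = (parallel_subspace A)\<^sup>\<bottom>"

lemma parallel_subspace_eq:
  assumes "affine A" and "a \<in> A"
  shows "parallel_subspace A = (\<lambda>x. x - a) ` A"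
proof -
  have ex1: "\<exists>!L. subspace L \<and> affine_parallel A L"
    using assms by (intro affine_parallel_subspace) auto
  have eq: "(\<lambda>x. x - a) ` A = (+) (- a) ` A"
    by (simp add: image_def)
  have "subspace ((+) (- a) ` A)"
    using subspace_affine assms affine_translation mem_affine
    by (metis add.left_inverse image_eqI)
  moreover have "affine_parallel A ((+) (- a) ` A)"
    unfolding affine_parallel_def by blast
  ultimately have "subspace ((\<lambda>x. x - a) ` A) \<and> affine_parallel A ((\<lambda>x. x - a) ` A)"
    by (simp only: eq simp_thms)
  then show ?thesis
    unfolding parallel_subspace_def using ex1 by (rule the1_equality[rotated])
qed

lemma affine_perp_eq:
  assumes "affine A" and "a \<in> A"
  shows "affine_perp A = ((\<lambda>x. x - a) ` A)\<^sup>\<bottom>"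
  using parallel_subspace_eq[OF assms] by (simp add: affine_perp_def)

end

theory Submission
  imports Defs
begin

text \<open>After translating a common point to the origin, \<open>A\<close> and \<open>B\<close> are linear subspaces \<open>U\<close> and
  \<open>V\<close> with orthogonal projectors \<open>P\<close> and \<open>Q\<close>, and the operator is
  \<open>T = P Q + (Id - P)(Id - Q)\<close>, a sum with orthogonal ranges. It fixes \<open>U\<^sup>\<bottom> \<inter> V\<^sup>\<bottom>\<close> pointwise,
  which is orthogonal to \<open>U \<inter> V\<close>, so a linear rate forces this space to vanish. Conversely, Pythagoras gives \<open>norm (T y) \<le> norm y\<close> with
  equality only if \<open>Q y \<in> U\<close> and \<open>y - Q y \<in> U\<^sup>\<bottom> \<inter> V\<^sup>\<bottom>\<close>; hence \<open>T\<close> shrinks every nonzero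
  vector orthogonal to \<open>U \<inter> V\<close>, with a uniform factor by compactness of the unit sphere.\<close>

section \<open>One-step form of the rate, and invariance under translation\<close>

lemma converges_linearly_to_iff:
  "converges_linearly_to T S \<longleftrightarrow>
     (\<exists>q::real. 0 \<le> q \<and> q < 1 \<and> (\<forall>x. infdist (T x) S \<le> q * infdist x S))"
proof -
  have "(\<forall>x n. infdist ((T ^^ Suc n) x) S \<le> q * infdist ((T ^^ n) x) S) \<longleftrightarrow>
      (\<forall>x. infdist (T x) S \<le> q * infdist x S)" (is "?l \<longleftrightarrow> ?r") for q
  proof
    assume l: ?l
    show ?r
    proof
      fix x show "infdist (T x) S \<le> q * infdist x S"
        \<comment> \<open>Every point is the iterate number 0 of its own orbit.\<close>
        using l[rule_format, of 0 x] by simp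
    qed
  qed simp
  then show ?thesis
    by (simp add: converges_linearly_to_def)
qed

lemma infdist_translation:
  fixes c :: "'a::real_normed_vector"
  shows "infdist (c + x) ((+) c ` S) = infdist x S"
  by (simp add: infdist_def image_image)

lemma closest_point_translation:
  fixes c :: "'a::euclidean_space"
  assumes "convex S" "closed S" "S \<noteq> {}"
  shows "closest_point ((+) c ` S) (c + x) = c + closest_point S x"
proof (rule closest_point_unique[symmetric])
  show "\<forall>z\<in>(+) c ` S. dist (c + x) (c + closest_point S x) \<le> dist (c + x) z"
    using closest_point_le[OF \<open>closed S\<close>] by auto
qed (simp_all add: assms closest_point_in_set closed_translation)

lemma douglas_rachford_translation:
  fixes c :: "'a::euclidean_space"
  assumes "subspace U" "subspace V"
  shows "douglas_rachford ((+) c ` U) ((+) c ` V) (c + x) = c + douglas_rachford U V x"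
proof -
  have "reflector ((+) c ` W) (c + y) = c + reflector W y" if "subspace W" for W :: "'a set" and y
  proof -
    have "W \<noteq> {}"
      using subspace_0[OF that] by blast
    then show ?thesis
      by (simp add: reflector_def closest_point_translation that subspace_imp_convex
          closed_subspace scaleR_2)
  qed
  with assms have "douglas_rachford ((+) c ` U) ((+) c ` V) (c + x) =
      (1/2) *\<^sub>R (2 *\<^sub>R c + (reflector U (reflector V x) + x))"
    by (simp add: douglas_rachford_def scaleR_2)
  also have "\<dots> = c + douglas_rachford U V x"
    by (simp add: douglas_rachford_def scaleR_right_distrib)
  finally show ?thesis .
qed

text \<open>Translation by \<open>c\<close> is an isometry that conjugates one operator into the
  other, so the same \<open>q\<close> serves both. This reduces affine sets through \<open>c\<close>
  to linear subspaces.\<close>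

lemma converges_linearly_to_douglas_rachford_translation:
  fixes c :: "'a::euclidean_space"
  assumes "subspace U" "subspace V"
  shows "converges_linearly_to (douglas_rachford ((+) c ` U) ((+) c ` V))
           ((+) c ` U \<inter> (+) c ` V) \<longleftrightarrow>
         converges_linearly_to (douglas_rachford U V) (U \<inter> V)"
proof -
  let ?T = "douglas_rachford ((+) c ` U) ((+) c ` V)" and ?S = "(+) c ` U \<inter> (+) c ` V"
  have S: "?S = (+) c ` (U \<inter> V)"
    by (simp add: image_Int)
  have all: "(\<forall>x. R x) \<longleftrightarrow> (\<forall>x. R (c + x))" for R
  proof
    assume R: "\<forall>x. R (c + x)"
    show "\<forall>x. R x"
    proof
      fix x show "R x"
        using R[rule_format, of "x - c"] by simp
    qed
  qed simp
  have "(\<forall>x. infdist (?T x) ?S \<le> q * infdist x ?S) \<longleftrightarrow>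
      (\<forall>x. infdist (douglas_rachford U V x) (U \<inter> V) \<le> q * infdist x (U \<inter> V))" for q
    unfolding S all[of "\<lambda>x. infdist (?T x) _ \<le> q * infdist x _"]
    by (simp add: infdist_translation douglas_rachford_translation assms)
  then show ?thesis
    by (simp add: converges_linearly_to_iff)
qed

section \<open>Orthogonal projectors onto linear subspaces\<close>

lemma closest_point_subspace_eqI:
  fixes U :: "'a::euclidean_space set"
  assumes "subspace U" "y \<in> U" "x - y \<in> U\<^sup>\<bottom>"
  shows "closest_point U x = y"
proof (rule closest_point_unique[symmetric])
  show "\<forall>z\<in>U. dist x y \<le> dist x z"
  proof
    fix z assume "z \<in> U"
    \<comment> \<open>Pythagoras applies to \<open>x - z = (x - y) + (y - z)\<close>: the first
      summand is orthogonal to \<open>U\<close>, the second lies in it.\<close>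
    with assms have "y - z \<in> U"
      by (simp add: subspace_diff)
    with assms(3) have "inner (x - y) (y - z) = 0"
      by (auto simp: orthogonal_comp_def orthogonal_def inner_commute[of "x - y"])
    then have "(norm (x - z))\<^sup>2 = (norm (x - y))\<^sup>2 + (norm (y - z))\<^sup>2"
      using norm_add_Pythagorean[of "x - y" "y - z"] by (simp add: orthogonal_def)
    then have "(norm (x - y))\<^sup>2 \<le> (norm (x - z))\<^sup>2"
      by simp
    then show "dist x y \<le> dist x z"
      unfolding dist_norm by (rule power2_le_imp_le) (rule norm_ge_zero)
  qed
qed (use assms in \<open>auto simp: subspace_imp_convex closed_subspace\<close>)

lemma diff_closest_point_subspace:
  fixes U :: "'a::euclidean_space set"
  assumes "subspace U"
  shows "x - closest_point U x \<in> U\<^sup>\<bottom>"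
proof -
  obtain y z where "y \<in> span U" "\<And>w. w \<in> span U \<Longrightarrow> orthogonal z w" "x = y + z"
    using orthogonal_subspace_decomp_exists by blast
  moreover have "span U = U"
    using assms by simp
  ultimately show ?thesis
    using closest_point_subspace_eqI[OF assms, of y x]
    by (simp add: orthogonal_comp_def orthogonal_commute)
qed

lemma closest_point_subspace_in:
  fixes U :: "'a::euclidean_space set"
  assumes "subspace U"
  shows "closest_point U x \<in> U"
  using assms subspace_0[OF assms] by (auto intro!: closest_point_in_set simp: closed_subspace)

text \<open>The projection is determined by lying in \<open>U\<close> with residual in
  \<open>U\<^sup>\<bottom>\<close>. Both sets are subspaces, so sums and multiples of projections
  again meet these conditions.\<close>

lemma linear_closest_point_subspace:
  fixes U :: "'a::euclidean_space set"
  assumes "subspace U"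
  shows "linear (closest_point U)"
proof
  note in' = closest_point_subspace_in[OF assms] diff_closest_point_subspace[OF assms]
  fix x y :: 'a and r :: real
  have "x - closest_point U x + (y - closest_point U y) \<in> U\<^sup>\<bottom>"
    using in' by (intro subspace_add subspace_orthogonal_comp)
  then show "closest_point U (x + y) = closest_point U x + closest_point U y"
    using in' by (intro closest_point_subspace_eqI assms subspace_add) (simp_all add: algebra_simps)
  have "r *\<^sub>R (x - closest_point U x) \<in> U\<^sup>\<bottom>"
    using in' by (intro subspace_mul subspace_orthogonal_comp)
  then show "closest_point U (r *\<^sub>R x) = r *\<^sub>R closest_point U x"
    using in' by (intro closest_point_subspace_eqI assms subspace_mul) (simp_all add: algebra_simps)
qed

section \<open>The operator on linear subspaces and its norm\<close>

lemma douglas_rachford_subspace: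
  fixes U V :: "'a::euclidean_space set"
  assumes "subspace U"
  shows "douglas_rachford U V x = closest_point U (closest_point V x) +
           (x - closest_point V x - closest_point U (x - closest_point V x))"
proof -
  interpret P: linear "closest_point U"
    by (rule linear_closest_point_subspace[OF assms])
  let ?p = "closest_point U" and ?y = "closest_point V x"
  \<comment> \<open>Expanding \<open>(2 P - Id)(2 Q - Id) + Id\<close> by linearity of
    \<open>P\<close> gives \<open>2 (P Q + (Id - P)(Id - Q))\<close>.\<close>
  have "reflector U (reflector V x) + x = 2 *\<^sub>R (?p ?y + (x - ?y - ?p (x - ?y)))"
    by (simp add: reflector_def P.add P.diff P.scale scaleR_2)
  then show ?thesis
    by (simp add: douglas_rachford_def)
qed

lemma linear_douglas_rachford:
  fixes U V :: "'a::euclidean_space set"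
  assumes "subspace U" "subspace V"
  shows "linear (douglas_rachford U V)"
proof -
  interpret P: linear "closest_point U"
    by (rule linear_closest_point_subspace[OF assms(1)])
  interpret Q: linear "closest_point V"
    by (rule linear_closest_point_subspace[OF assms(2)])
  show ?thesis
    by (rule linearI)
      (simp_all add: douglas_rachford_subspace assms P.add Q.add P.diff Q.diff P.scale Q.scale
        algebra_simps)
qed

lemma norm_closest_point_subspace:
  fixes U :: "'a::euclidean_space set"
  assumes "subspace U"
  shows "(norm x)\<^sup>2 = (norm (closest_point U x))\<^sup>2 + (norm (x - closest_point U x))\<^sup>2"
proof -
  have "orthogonal (closest_point U x) (x - closest_point U x)"
    using closest_point_subspace_in[OF assms] diff_closest_point_subspace[OF assms]
    by (auto simp: orthogonal_comp_def)
  from norm_add_Pythagorean[OF this] show ?thesis by simp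
qed

text \<open>Split \<open>x\<close> into \<open>Q x\<close> and \<open>x - Q x\<close>, and each of
  these along \<open>U\<close> and \<open>U\<^sup>\<bottom>\<close>. The operator keeps two of the
  four pieces, and the last two terms measure the pieces it discards.\<close>

lemma norm_douglas_rachford_subspace:
  fixes U V :: "'a::euclidean_space set"
  assumes "subspace U" "subspace V"
  defines "y \<equiv> \<lambda>x. closest_point V x"
  shows "(norm x)\<^sup>2 = (norm (douglas_rachford U V x))\<^sup>2 +
    (norm (y x - closest_point U (y x)))\<^sup>2 + (norm (closest_point U (x - y x)))\<^sup>2"
proof -
  have "orthogonal (closest_point U (y x)) (x - y x - closest_point U (x - y x))"
    using closest_point_subspace_in[OF assms(1)] diff_closest_point_subspace[OF assms(1)]
    by (auto simp: orthogonal_comp_def)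
  from norm_add_Pythagorean[OF this]
  have "(norm (douglas_rachford U V x))\<^sup>2 =
      (norm (closest_point U (y x)))\<^sup>2 + (norm (x - y x - closest_point U (x - y x)))\<^sup>2"
    by (simp add: douglas_rachford_subspace assms(1) y_def)
  with norm_closest_point_subspace[OF assms(2), of x]
    norm_closest_point_subspace[OF assms(1), of "y x"]
    norm_closest_point_subspace[OF assms(1), of "x - y x"]
  show ?thesis by (simp add: y_def)
qed

lemma norm_douglas_rachford_less:
  fixes U V :: "'a::euclidean_space set"
  assumes "subspace U" "subspace V" and perp: "U\<^sup>\<bottom> \<inter> V\<^sup>\<bottom> = {0}"
    and x: "x \<in> (U \<inter> V)\<^sup>\<bottom>" "x \<noteq> 0"
  shows "norm (douglas_rachford U V x) < norm x"
proof (rule ccontr)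
  assume "\<not> ?thesis"
  then have "(norm x)\<^sup>2 \<le> (norm (douglas_rachford U V x))\<^sup>2"
    by (simp add: power_mono)
  \<comment> \<open>No norm is lost, so both discarded pieces vanish.\<close>
  with norm_douglas_rachford_subspace[OF assms(1,2), of x]
  have "(norm (closest_point V x - closest_point U (closest_point V x)))\<^sup>2 = 0 \<and>
      (norm (closest_point U (x - closest_point V x)))\<^sup>2 = 0"
    by (smt (verit) zero_le_power2)
  then have *: "closest_point U (closest_point V x) = closest_point V x"
    "closest_point U (x - closest_point V x) = 0"
    by simp_all
  have "x - closest_point V x \<in> U\<^sup>\<bottom>"
    using diff_closest_point_subspace[OF assms(1), of "x - closest_point V x"] * by simp
  with diff_closest_point_subspace[OF assms(2), of x]
  have "x - closest_point V x \<in> U\<^sup>\<bottom> \<inter> V\<^sup>\<bottom>"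
    by blast
  then have "closest_point V x = x"
    by (simp add: perp)
  \<comment> \<open>Now \<open>x = Q x\<close> is in \<open>V\<close>, and
    \<open>P Q x = Q x\<close> puts it in \<open>U\<close>; but \<open>x\<close> is orthogonal to
    \<open>U \<inter> V\<close>, hence to itself.\<close>
  with * have "x \<in> U \<inter> V"
    by (metis IntI assms(1,2) closest_point_subspace_in)
  with x(1) have "orthogonal x x"
    by (simp add: orthogonal_comp_def)
  with x(2) show False
    by (simp add: orthogonal_self)
qed

text \<open>The factor is the maximum of \<open>norm (f x)\<close> over the unit sphere of
  \<open>W\<close>, which is attained by compactness and hence below 1; homogeneity extends the
  bound to all of \<open>W\<close>.\<close>

lemma linear_contraction_on_subspace:
  fixes f :: "'a::euclidean_space \<Rightarrow> 'b::real_normed_vector"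
  assumes "linear f" "subspace W" and less: "\<And>x. x \<in> W \<Longrightarrow> x \<noteq> 0 \<Longrightarrow> norm (f x) < norm x"
  obtains q where "0 \<le> q" "q < 1" "\<And>x. x \<in> W \<Longrightarrow> norm (f x) \<le> q * norm x"
proof (cases "W \<inter> sphere 0 1 = {}")
  \<comment> \<open>Without unit vectors \<open>W\<close> is trivial and there is no maximum to
    take; \<open>q = 0\<close> works.\<close>
  case True
  have "x = 0" if "x \<in> W" for x
  proof (rule ccontr)
    assume "x \<noteq> 0"
    with that assms(2) have "(1 / norm x) *\<^sub>R x \<in> W \<inter> sphere 0 1"
      by (simp add: subspace_mul)
    with True show False by blast
  qed
  then show thesis
    using that[of 0] linear_0[OF assms(1)] by force
next
  case False
  have "compact (W \<inter> sphere 0 1)"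
    by (simp add: closed_Int_compact closed_subspace assms(2))
  moreover have "continuous_on (W \<inter> sphere 0 1) (\<lambda>x. norm (f x))"
    by (intro continuous_on_norm linear_continuous_on linear_conv_bounded_linear[THEN iffD1] assms(1))
  ultimately obtain u where u: "u \<in> W \<inter> sphere 0 1"
    and max: "\<And>x. x \<in> W \<inter> sphere 0 1 \<Longrightarrow> norm (f x) \<le> norm (f u)"
    using continuous_attains_sup False by metis
  show thesis
  proof
    show "norm (f u) < 1"
      using less[of u] u by force
    fix x assume x: "x \<in> W"
    show "norm (f x) \<le> norm (f u) * norm x"
    proof (cases "x = 0")
      case True
      then show ?thesis using linear_0[OF assms(1)] by simp
    next
      case False
      then have "norm (f ((1 / norm x) *\<^sub>R x)) \<le> norm (f u)"
        using x assms(2) by (intro max) (simp add: subspace_mul)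
      with False show ?thesis
        by (simp add: linear_cmul[OF assms(1)] field_simps)
    qed
  qed simp
qed

section \<open>Fixed points and the equivalence for linear subspaces\<close>

lemma infdist_eq_dist_closest_point:
  assumes "closed S" "S \<noteq> {}"
  shows "infdist x S = dist x (closest_point S x)"
  using assms by (metis infdist_eq_setdist setdist_closest_point)

lemma douglas_rachford_fixes_Int:
  fixes U V :: "'a::euclidean_space set"
  assumes "subspace U" "x \<in> U \<inter> V"
  shows "douglas_rachford U V x = x"
  using assms
  by (simp add: douglas_rachford_subspace closest_point_self linear_0[OF linear_closest_point_subspace])

text \<open>Both projectors annihilate \<open>x\<close>, so only the summand
  \<open>(Id - P)(Id - Q)\<close> survives, and it returns \<open>x\<close>.\<close>

lemma douglas_rachford_fixes_orthogonal_comp_Int: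
  fixes U V :: "'a::euclidean_space set"
  assumes "subspace U" "subspace V" "x \<in> U\<^sup>\<bottom> \<inter> V\<^sup>\<bottom>"
  shows "douglas_rachford U V x = x"
proof -
  have "closest_point U x = 0" "closest_point V x = 0"
    using assms by (auto intro!: closest_point_subspace_eqI simp: subspace_0)
  then show ?thesis
    using assms
    by (simp add: douglas_rachford_subspace linear_0[OF linear_closest_point_subspace])
qed

lemma converges_linearly_to_douglas_rachford_subspace:
  fixes U V :: "'a::euclidean_space set"
  assumes "subspace U" "subspace V"
  shows "converges_linearly_to (douglas_rachford U V) (U \<inter> V) \<longleftrightarrow> U\<^sup>\<bottom> \<inter> V\<^sup>\<bottom> = {0}"
proof
  have M: "subspace (U \<inter> V)" "closed (U \<inter> V)" "U \<inter> V \<noteq> {}"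
    using assms by (auto simp: subspace_inter closed_subspace closed_Int dest: subspace_0)
  {
    assume "converges_linearly_to (douglas_rachford U V) (U \<inter> V)"
    then obtain q where q: "q < 1"
      "\<And>x. infdist (douglas_rachford U V x) (U \<inter> V) \<le> q * infdist x (U \<inter> V)"
      by (auto simp: converges_linearly_to_iff)
    have "x = 0" if x: "x \<in> U\<^sup>\<bottom> \<inter> V\<^sup>\<bottom>" for x
    proof -
      have "infdist x (U \<inter> V) \<le> q * infdist x (U \<inter> V)"
        using q(2)[of x] douglas_rachford_fixes_orthogonal_comp_Int[OF assms x] by simp
      \<comment> \<open>A nonnegative number that is at most \<open>q\<close> times itself, with
        \<open>q < 1\<close>, is 0.\<close>
      then have "infdist x (U \<inter> V) = 0"
        using q(1) infdist_nonneg[of x "U \<inter> V"]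
        by (smt (verit) mult_le_cancel_right1)
      then have "x \<in> U"
        using M in_closed_iff_infdist_zero by blast
      with x show ?thesis
        by (auto simp: orthogonal_comp_def orthogonal_self)
    qed
    then show "U\<^sup>\<bottom> \<inter> V\<^sup>\<bottom> = {0}"
      by (auto simp: subspace_0 subspace_orthogonal_comp)
  next
    let ?T = "douglas_rachford U V" and ?p = "closest_point (U \<inter> V)"
    assume perp: "U\<^sup>\<bottom> \<inter> V\<^sup>\<bottom> = {0}"
    obtain q where q: "0 \<le> q" "q < 1"
      "\<And>x. x \<in> (U \<inter> V)\<^sup>\<bottom> \<Longrightarrow> norm (?T x) \<le> q * norm x"
      using linear_contraction_on_subspace[OF linear_douglas_rachford[OF assms]
          subspace_orthogonal_comp norm_douglas_rachford_less[OF assms perp]] by metis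
    have "infdist (?T x) (U \<inter> V) \<le> q * infdist x (U \<inter> V)" for x
    proof -
      have p: "?p x \<in> U \<inter> V"
        by (rule closest_point_subspace_in[OF M(1)])
      \<comment> \<open>The operator fixes \<open>?p x\<close>, so by linearity the distance from
        \<open>?T x\<close> to it is the norm of the image of \<open>x - ?p x\<close>, a vector on
        which the contraction applies.\<close>
      have "infdist (?T x) (U \<inter> V) \<le> dist (?T x) (?p x)"
        using p by (rule infdist_le)
      also have "\<dots> = norm (?T (x - ?p x))"
        using douglas_rachford_fixes_Int[OF assms(1) p]
        by (simp add: dist_norm linear_diff[OF linear_douglas_rachford[OF assms]])
      also have "\<dots> \<le> q * norm (x - ?p x)"
        by (rule q(3)[OF diff_closest_point_subspace[OF M(1)]])
      also have "\<dots> = q * infdist x (U \<inter> V)"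
        by (simp add: infdist_eq_dist_closest_point M dist_norm)
      finally show ?thesis .
    qed
    with q show "converges_linearly_to ?T (U \<inter> V)"
      by (auto simp: converges_linearly_to_iff)
  }
qed

theorem corollary44:
  fixes A B :: "'a::euclidean_space set"
  assumes "affine A" and "affine B" and "A \<inter> B \<noteq> {}"
  shows "converges_linearly_to (douglas_rachford A B) (A \<inter> B) \<longleftrightarrow>
         affine_perp A \<inter> affine_perp B = {0}"
proof -
  obtain c where c: "c \<in> A" "c \<in> B"
    using assms(3) by blast
  \<comment> \<open>Subtracting one common point from both sets yields their parallel subspaces, so
    \<open>affine_perp\<close> becomes the ordinary orthogonal complement.\<close>
  let ?U = "(\<lambda>x. x - c) ` A" and ?V = "(\<lambda>x. x - c) ` B"
  have "subspace ?U" "subspace ?V"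
    using affine_diffs_subspace_subtract assms(1,2) c by auto
  moreover have "(+) c ` ?U = A" "(+) c ` ?V = B"
    by (simp_all add: image_image)
  ultimately show ?thesis
    using converges_linearly_to_douglas_rachford_translation[of ?U ?V c]
      converges_linearly_to_douglas_rachford_subspace[of ?U ?V]
    by (simp add: affine_perp_eq[OF assms(1) c(1)] affine_perp_eq[OF assms(2) c(2)])
qed

end
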